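(* Let $A\in\mathbb R^{p\times m}$ and $b\in\mathbb R^p$ be the balance-plus-normalisation matrix and right-hand side defined in the context, $M=\{x\in\mathbb R^m: Ax=b\}$, and $F_0(x)=\|Ax-b\|^2$ (Euclidean norm). Then: 1. $F_0$ is continuous and convex on $\mathbb R^m$ and coercive on the cone $\mathbb R^m_+$ (that is, $F_0(x)\to\infty$ as $\|x\|\to\infty$ with $x\in\mathbb R^m_+$). 2. The minimiser set $M_0=\{x\in\mathbb R^m_+:\ F_0(x)=\min_{y\in\mathbb R^m_+}F_0(y)\}$ is non-empty, convex and compact. 3. In the feasible case $M\cap\mathbb R^m_+\ne\varnothing$, one has $M_0=M\cap\mathbb R^m_+$, and this is a bounded polytope of dimension at most $2n^2+n$, with equality when $M\cap\mathbb R^m_{>0}\neq\varnothing$. 4. $M_0$ is either a single point or has the cardinality of the continuum. 5. $M_0$ carries a unique element of minimal Euclidean norm (the normal solution).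
   Context: Notation: $\mathbb R^m_+$ is the closed non-negative orthant and $\mathbb R^m_{>0}$ the open positive orthant. Fix an integer $n\ge 1$ and an instant $t$. The data are: counts at time $t$, $N_1^{(i)}(t)>0$ for $i=1,\dots,n$ (active clusters) and $N_2^{(i)}(t)>0$ for $i=0,\dots,n$ (passive clusters; index $0$ is the reserve); nonnegative counts $N_1^{(i)}(t+1)$, $N_2^{(i)}(t+1)$ at time $t+1$; and an exogenous inflow $\Delta N_2^{(0)}(t)\ge 0$. Put $N_{\mathrm{eff}}^{(0)}=\Delta N_2^{(0)}(t)+N_2^{(0)}(t)$. The unknown vector $x\in\mathbb R^m$, $m=2n^2+5n+2$, has the components $P_{11}^{(i,j)}$ ($1\le i\le n$, $j\in\{1,\dots,n+1\}\setminus\{i\}$), $P_{12}^{(i)}$ ($1\le i\le n$), $P_{21}^{(i,j)}$ ($0\le i\le n$, $1\le j\le n+1$), $P^{*(i)}$ ($0\le i\le n$), $P^{**(i)}$ ($1\le i\le n$); the destination index $j=n+1$ means departure from the system. With $p=4n+2$, the matrix $A\in\mathbb R^{p\times m}$ and vector $b\in\mathbb R^p$ are defined by declaring $Ax=b$ to be the following system of $p$ linear equations. Balance equations ($2n+1$ of them): for $i=1,\dots,n$, $$\sum_{j=1}^n N_2^{(j)}(t)P_{21}^{(j,i)}+N_{\mathrm{eff}}^{(0)}P_{21}^{(0,i)}+\sum_{j\le n,\,j\ne i}N_1^{(j)}(t)P_{11}^{(j,i)}-N_1^{(i)}(t)\Bigl[P_{12}^{(i)}+\sum_{j\le n+1,\,j\neq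 i}P_{11}^{(i,j)}\Bigr]=N_1^{(i)}(t+1)-N_1^{(i)}(t);$$ $$-N_{\mathrm{eff}}^{(0)}\sum_{j=1}^{n+1}P_{21}^{(0,j)}=N_2^{(0)}(t+1)-N_2^{(0)}(t)-\Delta N_2^{(0)}(t);$$ and for $i=1,\dots,n$, $\;N_1^{(i)}(t)P_{12}^{(i)}-N_2^{(i)}(t)\sum_{j=1}^{n+1}P_{21}^{(i,j)}=N_2^{(i)}(t+1)-N_2^{(i)}(t)$. Normalisation equations ($2n+1$ of them): $P_{12}^{(i)}+\sum_{j\le n+1,\,j\ne i}P_{11}^{(i,j)}+P^{**(i)}=1$ for $i=1,\dots,n$, and $\sum_{j=1}^{n+1}P_{21}^{(i,j)}+P^{*(i)}=1$ for $i=0,\dots,n$. *)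

theory Defs
  imports "HOL-Analysis.Analysis" "HOL-Library.Equipollence"
begin

text \<open>
  The active (and the non-reserve passive) clusters are the elements of a finite type
  \<open>'n\<close>, so that \<open>n = CARD('n)\<close> and \<open>n \<ge> 1\<close> automatically. The type \<open>'n option\<close> is used in two ways:
  as a passive cluster, \<open>None\<close> is the reserve (index \<open>0\<close>); as a destination,
  \<open>None\<close> is departure from the system (index \<open>n + 1\<close>).
\<close>

text \<open>Pairs (source, destination) that index the active-to-active unknowns: \<open>j \<noteq> i\<close>.\<close>

typedef 'n route = "{(i :: 'n, j :: 'n option). j \<noteq> Some i}"
  by auto

instance route :: (finite) finite
proof
  have "(UNIV :: 'a route set) = Abs_route ` {(i, j). j \<noteq> Some i}"
    by (rule type_definition.Abs_image[OF type_definition_route, symmetric])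
  then show "finite (UNIV :: 'a route set)"
    by (metis finite finite_imageI)
qed

text \<open>The coordinates of \<open>x\<close>; \<open>P21 i j\<close> has a passive cluster \<open>i\<close> and a destination \<open>j\<close>.\<close>

datatype 'n unknown =
    P11_route "'n route"
  | P12 'n
  | P21 "'n option" "'n option"
  | Pstar "'n option"
  | Pstarstar 'n

text \<open>Only meaningful for \<open>j \<noteq> Some i\<close>.\<close>

definition P11 :: "'n \<Rightarrow> 'n option \<Rightarrow> 'n unknown" where
  "P11 i j = P11_route (Abs_route (i, j))"

datatype 'n equation =
    Bal_active 'n
  | Bal_reserve
  | Bal_passive 'n
  | Norm_active 'n
  | Norm_passive "'n option"

lemma UNIV_unknown:
  "(UNIV :: 'n unknown set) =
     range P11_route \<union> range P12 \<union> range (\<lambda>(i, j). P21 i j) \<union> range Pstar \<union> range Pstarstar"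
proof -
  have "u \<in> range P11_route \<union> range P12 \<union> range (\<lambda>(i, j). P21 i j) \<union> range Pstar \<union> range Pstarstar"
    for u :: "'n unknown"
    by (cases u) auto
  then show ?thesis by blast
qed

instance unknown :: (finite) finite
proof
  show "finite (UNIV :: 'a unknown set)"
    unfolding UNIV_unknown by (intro finite_UnI finite_imageI finite)
qed

lemma UNIV_equation:
  "(UNIV :: 'n equation set) =
     range Bal_active \<union> {Bal_reserve} \<union> range Bal_passive \<union> range Norm_active \<union> range Norm_passive"
proof -
  have "e \<in> range Bal_active \<union> {Bal_reserve} \<union> range Bal_passive \<union> range Norm_active \<union> range Norm_passive"
    for e :: "'n equation"
    by (cases e) auto
  then show ?thesis by blast
qed

instance equation :: (finite) finite
proof
  show "finite (UNIV :: 'a equation set)"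
    unfolding UNIV_equation by (intro finite_UnI finite_imageI finite.intros finite)
qed

lemma card_route: "CARD('n::finite route) = CARD('n)\<^sup>2"
proof -
  have "CARD('n route) = card {(i :: 'n, j :: 'n option). j \<noteq> Some i}"
    by (rule type_definition.card[OF type_definition_route])
  also have "{(i :: 'n, j :: 'n option). j \<noteq> Some i} = (SIGMA i:UNIV. UNIV - {Some i})"
    by auto
  also have "card \<dots> = CARD('n)\<^sup>2"
    by (subst card_SigmaI) (auto simp: card_Diff_singleton power2_eq_square)
  finally show ?thesis .
qed

lemma card_unknown: "CARD('n::finite unknown) = 2 * CARD('n)\<^sup>2 + 5 * CARD('n) + 2"
proof -
  have "CARD('n unknown) =
      card (range (P11_route :: 'n route \<Rightarrow> _)) + card (range (P12 :: 'n \<Rightarrow> _))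
      + card (range (\<lambda>(i :: 'n option, j). P21 i j)) + card (range (Pstar :: 'n option \<Rightarrow> _))
      + card (range (Pstarstar :: 'n \<Rightarrow> _))"
    unfolding UNIV_unknown
    by (subst card_Un_disjoint, simp, simp, force)+ simp
  also have "\<dots> = CARD('n route) + CARD('n) + CARD('n option \<times> 'n option)
      + CARD('n option) + CARD('n)"
    by (subst card_image, force intro: injI)+ simp
  finally show ?thesis
    by (simp add: card_route power2_eq_square algebra_simps)
qed

lemma card_equation: "CARD('n::finite equation) = 4 * CARD('n) + 2"
proof -
  have "CARD('n equation) =
      card (range (Bal_active :: 'n \<Rightarrow> _)) + card {Bal_reserve :: 'n equation}
      + card (range (Bal_passive :: 'n \<Rightarrow> _)) + card (range (Norm_active :: 'n \<Rightarrow> _))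
      + card (range (Norm_passive :: 'n option \<Rightarrow> _))"
    unfolding UNIV_equation
    by (subst card_Un_disjoint, simp, simp, force)+ simp
  also have "\<dots> = CARD('n) + 1 + CARD('n) + CARD('n) + CARD('n option)"
    by (subst card_image, force intro: injI)+ simp
  finally show ?thesis by simp
qed

text \<open>
  \<open>N1\<close>, \<open>N2\<close> are the counts at time \<open>t\<close>, \<open>N1'\<close>, \<open>N2'\<close> those at time \<open>t + 1\<close>, and \<open>dN\<close> is the
  inflow into the reserve.
\<close>

fun eq_lhs ::
  "('n::finite \<Rightarrow> real) \<Rightarrow> ('n option \<Rightarrow> real) \<Rightarrow> real \<Rightarrow> real ^ 'n unknown \<Rightarrow> 'n equation \<Rightarrow> real"
where
  "eq_lhs N1 N2 dN x (Bal_active i) =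
     (\<Sum>j\<in>UNIV. N2 (Some j) * x $ P21 (Some j) (Some i))
     + (dN + N2 None) * x $ P21 None (Some i)
     + (\<Sum>j\<in>UNIV - {i}. N1 j * x $ P11 j (Some i))
     - N1 i * (x $ P12 i + (\<Sum>j\<in>UNIV - {Some i}. x $ P11 i j))"
| "eq_lhs N1 N2 dN x Bal_reserve =
     - (dN + N2 None) * (\<Sum>j\<in>UNIV. x $ P21 None j)"
| "eq_lhs N1 N2 dN x (Bal_passive i) =
     N1 i * x $ P12 i - N2 (Some i) * (\<Sum>j\<in>UNIV. x $ P21 (Some i) j)"
| "eq_lhs N1 N2 dN x (Norm_active i) =
     x $ P12 i + (\<Sum>j\<in>UNIV - {Some i}. x $ P11 i j) + x $ Pstarstar i"
| "eq_lhs N1 N2 dN x (Norm_passive i) =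
     (\<Sum>j\<in>UNIV. x $ P21 i j) + x $ Pstar i"

fun eq_rhs ::
  "('n \<Rightarrow> real) \<Rightarrow> ('n option \<Rightarrow> real) \<Rightarrow> real \<Rightarrow> ('n \<Rightarrow> real) \<Rightarrow> ('n option \<Rightarrow> real)
    \<Rightarrow> 'n equation \<Rightarrow> real"
where
  "eq_rhs N1 N2 dN N1' N2' (Bal_active i) = N1' i - N1 i"
| "eq_rhs N1 N2 dN N1' N2' Bal_reserve = N2' None - N2 None - dN"
| "eq_rhs N1 N2 dN N1' N2' (Bal_passive i) = N2' (Some i) - N2 (Some i)"
| "eq_rhs N1 N2 dN N1' N2' (Norm_active i) = 1"
| "eq_rhs N1 N2 dN N1' N2' (Norm_passive i) = 1"

definition system_matrix ::
  "('n::finite \<Rightarrow> real) \<Rightarrow> ('n option \<Rightarrow> real) \<Rightarrow> real \<Rightarrow> real ^ 'n unknown ^ 'n equation"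
where
  "system_matrix N1 N2 dN = matrix (\<lambda>x. \<chi> e. eq_lhs N1 N2 dN x e)"

definition system_rhs ::
  "('n::finite \<Rightarrow> real) \<Rightarrow> ('n option \<Rightarrow> real) \<Rightarrow> real \<Rightarrow> ('n \<Rightarrow> real) \<Rightarrow> ('n option \<Rightarrow> real)
    \<Rightarrow> real ^ 'n equation"
where
  "system_rhs N1 N2 dN N1' N2' = (\<chi> e. eq_rhs N1 N2 dN N1' N2' e)"

lemma linear_eq_lhs: "linear (\<lambda>x. eq_lhs N1 N2 dN x e)"
  by (cases e; rule linearI)
     (simp_all add: sum.distrib sum_distrib_left algebra_simps)

lemma system_matrix_mult: "system_matrix N1 N2 dN *v x = (\<chi> e. eq_lhs N1 N2 dN x e)"
proof -
  have "linear (\<lambda>x. \<chi> e. eq_lhs N1 N2 dN x e)"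
    by (rule linearI)
       (simp_all add: vec_eq_iff linear_add[OF linear_eq_lhs] linear_cmul[OF linear_eq_lhs])
  then show ?thesis
    unfolding system_matrix_def by (simp add: matrix_works[of "\<lambda>x. \<chi> e. eq_lhs N1 N2 dN x e"])
qed

lemma system_iff:
  "system_matrix N1 N2 dN *v x = system_rhs N1 N2 dN N1' N2' \<longleftrightarrow>
     (\<forall>e. eq_lhs N1 N2 dN x e = eq_rhs N1 N2 dN N1' N2' e)"
  by (simp add: system_matrix_mult system_rhs_def vec_eq_iff)

definition nonneg_orthant :: "(real ^ 'm) set" where
  "nonneg_orthant = {x. \<forall>k. 0 \<le> x $ k}"

definition pos_orthant :: "(real ^ 'm) set" where
  "pos_orthant = {x. \<forall>k. 0 < x $ k}"

definition F0 :: "real ^ 'm ^ 'p \<Rightarrow> real ^ 'p \<Rightarrow> real ^ 'm \<Rightarrow> real" where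
  "F0 A b x = (norm (A *v x - b))\<^sup>2"

end

theory Submission
  imports Defs
begin

text \<open>
  On the orthant each unknown is bounded by the left-hand side of the normalisation equation that
  contains it, so \<open>\<parallel>x\<parallel> \<le> m \<parallel>A x\<parallel>\<close> there; hence coercivity, and the minimisers form a
  non-empty compact convex set. The departure probabilities and the slacks \<open>P\<^sup>*\<close>, \<open>P\<^sup>*\<^sup>*\<close> each occur
  with non-zero coefficient, and solving for them (all other unknowns zero) shows that \<open>A\<close> has full
  rank \<open>p\<close>. Hence \<open>M\<close> has dimension \<open>m - p = 2n\<^sup>2 + n\<close>, and the open orthant cuts out of it,
  if it meets it at all, a relatively open subset.
\<close>

section \<open>Dimension of the solution set of a system of full rank\<close>

text \<open>The solution set is a translate of the kernel, which is the orthogonal complement of the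
  row space; by surjectivity the row space has dimension \<open>CARD('p)\<close>.\<close>

lemma aff_dim_solutions:
  fixes A :: "real ^ 'm ^ 'p" and b :: "real ^ 'p"
  assumes "surj ((*v) A)"
  shows "aff_dim {x. A *v x = b} = int CARD('m) - int CARD('p)"
proof -
  obtain x0 where x0: "A *v x0 = b" using assms by (metis surjD)
  let ?K = "{x. A *v x = 0}"
  have "{x. A *v x = b} = (+) x0 ` ?K"
  proof (intro equalityI subsetI)
    fix x assume "x \<in> {x. A *v x = b}"
    then have "x - x0 \<in> ?K" by (simp add: x0 matrix_vector_mult_diff_distrib)
    then show "x \<in> (+) x0 ` ?K" by (metis image_eqI diff_add_cancel add.commute)
  qed (auto simp: x0 matrix_vector_right_distrib)
  then have "aff_dim {x. A *v x = b} = aff_dim ?K" by (simp add: aff_dim_translation_eq)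
  also have "subspace ?K"
    by (simp add: subspace_def matrix_vector_right_distrib matrix_vector_mult_scaleR)
  then have "aff_dim ?K = int (dim ?K)" by (rule aff_dim_subspace)
  \<comment> \<open>This is the shape in which \<open>dim_subspace_orthogonal_to_vectors\<close>
    states that complementary dimensions add up.\<close>
  also have "?K = {x \<in> UNIV. \<forall>r\<in>span (rows A). orthogonal r x}"
  proof (intro set_eqI iffI)
    fix x assume "x \<in> ?K"
    then show "x \<in> {x \<in> UNIV. \<forall>r\<in>span (rows A). orthogonal r x}"
      using orthogonal_nullspace_rowspace orthogonal_commute by blast
  next
    fix x assume "x \<in> {x \<in> UNIV. \<forall>r\<in>span (rows A). orthogonal r x}"
    then have "row e A \<bullet> x = 0" for e
      by (auto simp: rows_def orthogonal_def intro: span_base)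
    then show "x \<in> ?K" by (simp add: vec_eq_iff matrix_vector_mult_def row_def inner_vec_def)
  qed
  also have "dim \<dots> + dim (span (rows A)) = CARD('m)"
    using dim_subspace_orthogonal_to_vectors[of "span (rows A)" UNIV] by simp
  then have "int (dim {x \<in> UNIV. \<forall>r\<in>span (rows A). orthogonal r x}) = int CARD('m) - int CARD('p)"
    using assms by (simp add: full_rank_surjective[symmetric] row_rank_def)
  finally show ?thesis .
qed

section \<open>Cardinality of convex sets\<close>

text \<open>In a T1 space a point is determined by the members of a countable basis that contain it,
  and these can be coded as a set of naturals.\<close>

lemma lepoll_nat_sets:
  fixes S :: "'a::{second_countable_topology,t1_space} set"
  shows "S \<lesssim> (UNIV :: nat set set)"
proof -
  obtain B :: "'a set set" where B: "countable B" "topological_basis B"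
    using ex_countable_basis by blast
  have "inj_on (\<lambda>x. to_nat_on B ` {U \<in> B. x \<in> U}) S"
  proof (rule inj_onI, rule ccontr)
    fix x y assume "to_nat_on B ` {U \<in> B. x \<in> U} = to_nat_on B ` {U \<in> B. y \<in> U}" and "x \<noteq> y"
    then have same: "{U \<in> B. x \<in> U} = {U \<in> B. y \<in> U}"
      using inj_on_image_eq_iff[OF inj_on_to_nat_on[OF B(1)], of "{U \<in> B. x \<in> U}" "{U \<in> B. y \<in> U}"]
      by blast
    obtain V where "open V" "x \<in> V" "y \<notin> V" using t1_space[OF \<open>x \<noteq> y\<close>] by blast
    moreover from this obtain U where "U \<in> B" "x \<in> U" "U \<subseteq> V"
      using topological_basisE[OF B(2)] by metis
    ultimately show False using same by blast
  qed
  then show ?thesis unfolding lepoll_def by blast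
qed

text \<open>Two distinct points of \<open>S\<close> span a segment inside \<open>S\<close>, a copy
  of the unit interval. The coding by sets of naturals gives the converse bound, and
  Schroeder-Bernstein concludes.\<close>

lemma singleton_or_eqpoll_reals:
  fixes S :: "'a::euclidean_space set"
  assumes "convex S" "S \<noteq> {}"
  shows "(\<exists>x. S = {x}) \<or> S \<approx> (UNIV :: real set)"
proof (cases "\<exists>x. S = {x}")
  case False
  then obtain x y where xy: "x \<in> S" "y \<in> S" "x \<noteq> y" using assms by blast
  have "inj_on (\<lambda>u. (1 - u) *\<^sub>R x + u *\<^sub>R y) {0..1::real}"
  proof (rule inj_onI)
    fix u v assume "(1 - u) *\<^sub>R x + u *\<^sub>R y = (1 - v) *\<^sub>R x + v *\<^sub>R y"
    then have "(u - v) *\<^sub>R (y - x) = 0" by (simp add: algebra_simps)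
    then show "u = v" using xy by simp
  qed
  moreover have "(\<lambda>u. (1 - u) *\<^sub>R x + u *\<^sub>R y) ` {0..1} \<subseteq> S"
    using convexD_alt[OF assms(1) xy(1,2)] by auto
  ultimately have "{0..1::real} \<lesssim> S" unfolding lepoll_def by blast
  then have "(UNIV :: real set) \<lesssim> S"
    using lepoll_trans1 eqpoll_sym closed_interval_eqpoll_reals by (metis zero_less_one)
  moreover have "S \<lesssim> (UNIV :: real set)"
    by (rule lepoll_trans2[OF lepoll_nat_sets nat_sets_eqpoll_reals])
  ultimately show ?thesis by (simp add: lepoll_antisym)
qed simp

section \<open>Convexity and continuity of the residual; the normal solution\<close>

text \<open>The norm of an affine map is convex, and squaring is monotone on non-negative reals and
  convex.\<close>

lemma convex_on_F0: "convex_on UNIV (F0 A b)"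
proof (rule convex_onI)
  fix t :: real and x y assume t: "0 < t" "t < 1"
  let ?u = "norm (A *v x - b)" and ?v = "norm (A *v y - b)"
  have "A *v ((1 - t) *\<^sub>R x + t *\<^sub>R y) - b
      = (1 - t) *\<^sub>R (A *v x - b) + t *\<^sub>R (A *v y - b)"
    by (simp add: matrix_vector_right_distrib matrix_vector_mult_scaleR
        matrix_vector_mult_diff_distrib scaleR_diff_right
        scaleR_diff_left)
  also have "norm \<dots> \<le> (1 - t) * ?u + t * ?v"
    using norm_triangle_ineq[of "(1 - t) *\<^sub>R (A *v x - b)" "t *\<^sub>R (A *v y - b)"] t by simp
  finally have "F0 A b ((1 - t) *\<^sub>R x + t *\<^sub>R y) \<le> ((1 - t) * ?u + t * ?v)\<^sup>2"
    unfolding F0_def by (rule power_mono) simp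
  also have "\<dots> \<le> (1 - t) * ?u\<^sup>2 + t * ?v\<^sup>2"
    using convex_onD[OF convex_power_even[of 2], of t ?u ?v] t by simp
  finally show "F0 A b ((1 - t) *\<^sub>R x + t *\<^sub>R y) \<le> (1 - t) * F0 A b x + t * F0 A b y"
    by (simp add: F0_def)
qed simp

lemma continuous_on_F0: "continuous_on S (F0 A b)"
  unfolding F0_def by (intro continuous_intros)

text \<open>Points of least norm are the points of \<open>S\<close> closest to the origin, and
  projection onto a closed convex set is unique.\<close>

lemma ex1_min_norm:
  fixes S :: "'a::euclidean_space set"
  assumes "convex S" "closed S" "S \<noteq> {}"
  shows "\<exists>!x. is_arg_min norm (\<lambda>y. y \<in> S) x"
proof -
  obtain x where x: "x \<in> S" "\<And>y. y \<in> S \<Longrightarrow> dist 0 x \<le> dist 0 y"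
    using distance_attains_inf assms(2,3) by metis
  show ?thesis
  proof (rule ex1I)
    show "is_arg_min norm (\<lambda>y. y \<in> S) x"
      using x by (auto simp: is_arg_min_linorder)
    fix y assume "is_arg_min norm (\<lambda>y. y \<in> S) y"
    then show "y = x"
      using any_closest_point_unique[OF assms(1,2), of y x 0] x by (auto simp: is_arg_min_linorder)
  qed
qed

section \<open>The constraints as polyhedra\<close>

lemma polyhedron_nonneg_orthant: "polyhedron (nonneg_orthant :: (real ^ 'm) set)"
proof -
  have "nonneg_orthant = (\<Inter>k. {x :: real ^ 'm. 0 \<le> axis k 1 \<bullet> x})"
    by (auto simp: nonneg_orthant_def inner_axis')
  also have "polyhedron \<dots>" by (auto intro!: polyhedron_halfspace_ge)
  finally show ?thesis .
qed

lemma polyhedron_solutions: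
  fixes A :: "real ^ 'm ^ 'p"
  shows "polyhedron {x. A *v x = b}"
proof -
  have "{x. A *v x = b} = (\<Inter>e. {x. row e A \<bullet> x = b $ e})"
    by (auto simp: vec_eq_iff matrix_vector_mult_def row_def inner_vec_def)
  then show ?thesis by (auto intro!: polyhedron_hyperplane)
qed

section \<open>Full rank of the system, and bounds on the orthant\<close>

lemma surj_system_matrix:
  fixes N1 :: "'n::finite \<Rightarrow> real"
  assumes "\<And>i. N1 i \<noteq> 0" "\<And>i. N2 (Some i) \<noteq> 0" "dN + N2 None \<noteq> 0"
  shows "surj ((*v) (system_matrix N1 N2 dN))"
proof (rule surjI)
  fix c :: "real ^ 'n equation"
  \<comment> \<open>With departures as the only moves, each balance equation retains a single
    unknown. \<open>?a\<close> and \<open>?q\<close> are its solutions for active and passive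
    sources; the slacks then absorb what the normalisation equations leave over.\<close>
  let ?a = "\<lambda>i. - c $ Bal_active i / N1 i"
  let ?q = "case_option (- c $ Bal_reserve / (dN + N2 None))
     (\<lambda>i. - c $ Bal_passive i / N2 (Some i))"
  let ?x = "\<chi> k. case k of
      P11_route r \<Rightarrow> (case Rep_route r of (i, j) \<Rightarrow> if j = None then ?a i else 0)
    | P12 i \<Rightarrow> 0
    | P21 i j \<Rightarrow> if j = None then ?q i else 0
    | Pstar i \<Rightarrow> c $ Norm_passive i - ?q i
    | Pstarstar i \<Rightarrow> c $ Norm_active i - ?a i"
  have P11: "?x $ P11 i j = (if j = None then ?a i else 0)" if "j \<noteq> Some i" for i j
    using that by (simp add: P11_def Abs_route_inverse)
  have S: "(\<Sum>j\<in>UNIV - {Some i}. ?x $ P11 i j) = ?a i" for i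
  proof -
    have "(\<Sum>j\<in>UNIV - {Some i}. ?x $ P11 i j) = (\<Sum>j\<in>UNIV - {Some i}. if j = None then ?a i else 0)"
      by (rule sum.cong) (use P11 in auto)
    also have "\<dots> = ?a i" by simp
    finally show ?thesis .
  qed
  \<comment> \<open>A destination \<open>Some i\<close> is not a departure, so all inflow from other
    active clusters is zero.\<close>
  have T: "(\<Sum>j\<in>UNIV - {i}. N1 j * ?x $ P11 j (Some i)) = 0" for i
    by (rule sum.neutral) (auto simp: P11 simp del: vec_lambda_beta)
  have "eq_lhs N1 N2 dN ?x e = c $ e" for e
  proof (cases e)
    case (Bal_active i)
    show ?thesis unfolding Bal_active eq_lhs.simps S T using assms by simp
  next
    case (Norm_active i)
    show ?thesis unfolding Norm_active eq_lhs.simps S by simp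
  next
    case Bal_reserve
    have "(\<Sum>j\<in>UNIV. ?x $ P21 None j) = - c $ Bal_reserve / (dN + N2 None)" by simp
    then show ?thesis unfolding Bal_reserve eq_lhs.simps
      using assms(3) by (simp only: mult_minus_left) (simp add: field_simps)
  qed (use assms in auto)
  then show "system_matrix N1 N2 dN *v ?x = c"
    by (simp add: system_matrix_mult vec_eq_iff)
qed

text \<open>Every unknown occurs in a normalisation equation with coefficient 1, next to terms that
  are non-negative on the orthant.\<close>

lemma nonneg_component_le_norm:
  fixes x :: "real ^ 'n::finite unknown"
  assumes "x \<in> nonneg_orthant"
  shows "x $ k \<le> norm (system_matrix N1 N2 dN *v x)"
proof -
  have nn: "0 \<le> x $ l" for l using assms by (simp add: nonneg_orthant_def)
  have "\<exists>e. x $ k \<le> eq_lhs N1 N2 dN x e"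
  proof (cases k)
    case (P11_route r)
    obtain i j where r: "Rep_route r = (i, j)" by fastforce
    then have "j \<noteq> Some i" using Rep_route[of r] by simp
    \<comment> \<open>\<open>Rep_route\<close> ensures \<open>j \<noteq> Some i\<close>, so the
      coordinate is a genuine summand of the normalisation sum, which is written with
      \<open>P11\<close>.\<close>
    moreover have "k = P11 i j" unfolding P11_def r[symmetric] by (simp add: Rep_route_inverse P11_route)
    ultimately have "x $ k \<le> (\<Sum>j\<in>UNIV - {Some i}. x $ P11 i j)"
      using member_le_sum[of j "UNIV - {Some i}" "\<lambda>j. x $ P11 i j"] nn by simp
    then have "x $ k \<le> eq_lhs N1 N2 dN x (Norm_active i)"
      using nn[of "P12 i"] nn[of "Pstarstar i"] by simp
    then show ?thesis ..
  next
    case (P12 i)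
    then have "x $ k \<le> eq_lhs N1 N2 dN x (Norm_active i)" using nn by (simp add: sum_nonneg)
    then show ?thesis ..
  next
    case (P21 i j)
    then have "x $ k \<le> (\<Sum>j\<in>UNIV. x $ P21 i j)"
      using member_le_sum[of j UNIV "\<lambda>j. x $ P21 i j"] nn by simp
    then have "x $ k \<le> eq_lhs N1 N2 dN x (Norm_passive i)" using nn[of "Pstar i"] by simp
    then show ?thesis ..
  next
    case (Pstar i)
    then have "x $ k \<le> eq_lhs N1 N2 dN x (Norm_passive i)" using nn by (simp add: sum_nonneg)
    then show ?thesis ..
  next
    case (Pstarstar i)
    then have "x $ k \<le> eq_lhs N1 N2 dN x (Norm_active i)" using nn by (simp add: sum_nonneg)
    then show ?thesis ..
  qed
  then obtain e where "x $ k \<le> (system_matrix N1 N2 dN *v x) $ e"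
    by (auto simp: system_matrix_mult)
  also have "\<dots> \<le> norm (system_matrix N1 N2 dN *v x)"
    by (metis abs_ge_self component_le_norm_cart order_trans)
  finally show ?thesis .
qed

section \<open>Coercivity and the set of minimisers\<close>

lemma open_pos_orthant: "open (pos_orthant :: (real ^ 'm) set)"
proof -
  have "pos_orthant = (\<Inter>k. {x :: real ^ 'm. 0 < x $ k})"
    by (auto simp: pos_orthant_def)
  also have "open \<dots>" by (intro open_INT ballI open_Collect_less continuous_intros) auto
  finally show ?thesis .
qed

lemma filterlim_F0:
  fixes A :: "real ^ 'm ^ 'p"
  assumes bound: "\<And>x. x \<in> S \<Longrightarrow> norm x \<le> C * norm (A *v x)" and "0 < C"
  shows "filterlim (F0 A b) at_top (inf at_infinity (principal S))"
  unfolding filterlim_at_top eventually_inf_principal eventually_at_infinity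
proof (intro allI exI impI)
  \<comment> \<open>The \<open>max 1\<close> forces the residual norm to be at least 1, so that its
    square dominates it.\<close>
  fix Z x assume *: "C * (norm b + max 1 Z) \<le> norm x" "x \<in> S"
  with bound have "C * (norm b + max 1 Z) \<le> C * norm (A *v x)" by (meson order_trans)
  then have "norm b + max 1 Z \<le> norm (A *v x)" using \<open>0 < C\<close> by simp
  then have "max 1 Z \<le> norm (A *v x - b)"
    using norm_triangle_ineq2[of "A *v x" b] by linarith
  then have "Z \<le> norm (A *v x - b)" "norm (A *v x - b) \<le> (norm (A *v x - b))\<^sup>2"
    by (auto intro: self_le_power)
  then show "Z \<le> F0 A b x" unfolding F0_def by linarith
qed

text \<open>Coercivity makes the sublevel sets on \<open>S\<close> compact, so the minimum is
  attained. The minimisers form the sublevel set at the minimal value, which is convex because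
  \<open>f\<close> is.\<close>

lemma coercive_arg_min_set:
  fixes f :: "'a::euclidean_space \<Rightarrow> real"
  assumes cont: "continuous_on S f" and conv: "convex_on S f"
    and coercive: "filterlim f at_top (inf at_infinity (principal S))"
    and S: "closed S" "S \<noteq> {}"
  defines "K \<equiv> {x. is_arg_min f (\<lambda>y. y \<in> S) x}"
  shows "K \<noteq> {}" "convex K" "compact K"
proof -
  obtain x0 where x0: "x0 \<in> S" using S by blast
  define L where "L c = {x \<in> S. f x \<le> c}" for c
  have "bounded (L c)" for c
  proof -
    have "\<forall>\<^sub>F x in inf at_infinity (principal S). c < f x"
      using coercive by (simp add: filterlim_at_top_dense)
    then obtain r where "\<And>x. r \<le> norm x \<Longrightarrow> x \<in> S \<Longrightarrow> c < f x"
      unfolding eventually_inf_principal eventually_at_infinity by blast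
    then have "norm x \<le> r" if "x \<in> L c" for x
      using that unfolding L_def by (metis linear mem_Collect_eq not_less)
    then show ?thesis unfolding bounded_iff by blast
  qed
  moreover have "closed (L c)" for c
    unfolding L_def by (rule continuous_on_closed_Collect_le[OF cont continuous_on_const S(1)])
  ultimately have compact_L: "compact (L c)" for c by (simp add: compact_eq_bounded_closed)
  have "continuous_on (L (f x0)) f"
    using cont by (rule continuous_on_subset) (auto simp: L_def)
  moreover have "x0 \<in> L (f x0)" using x0 by (simp add: L_def)
  ultimately obtain z where z: "z \<in> L (f x0)" "\<And>y. y \<in> L (f x0) \<Longrightarrow> f z \<le> f y"
    using continuous_attains_inf[OF compact_L] by blast
  \<comment> \<open>Outside the sublevel set of \<open>x0\<close> the value exceeds
    \<open>f x0\<close>, hence also \<open>f z\<close>.\<close>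
  have min: "f z \<le> f y" if "y \<in> S" for y
    using z that unfolding L_def by (cases "f y \<le> f x0") auto
  have "z \<in> S" using z(1) by (simp add: L_def)
  then have K: "K = L (f z)"
    using min unfolding K_def L_def is_arg_min_linorder by (auto intro: order_trans)
  show "K \<noteq> {}" unfolding K L_def using \<open>z \<in> S\<close> by blast
  show "compact K" unfolding K by (rule compact_L)
  show "convex K" unfolding K L_def
  proof (rule convexI, safe)
    fix x y and u v :: real
    assume *: "x \<in> S" "y \<in> S" "f x \<le> f z" "f y \<le> f z" "0 \<le> u" "0 \<le> v" "u + v = 1"
    show "u *\<^sub>R x + v *\<^sub>R y \<in> S"
      using convex_on_imp_convex[OF conv] * by (simp add: convexD)
    have "f (u *\<^sub>R x + v *\<^sub>R y) \<le> u * f x + v * f y"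
      using conv * by (simp add: convex_on_def)
    also have "\<dots> \<le> f z" using * by (intro convex_bound_le)
    finally show "f (u *\<^sub>R x + v *\<^sub>R y) \<le> f z" .
  qed
qed

theorem theorem1:
  fixes N1 N1' :: "'n::finite \<Rightarrow> real"
    and N2 N2' :: "'n option \<Rightarrow> real"
    and dN :: real
    and A :: "real ^ 'n unknown ^ 'n equation"
    and b :: "real ^ 'n equation"
    and M M0 :: "(real ^ 'n unknown) set"
  assumes "\<forall>i. N1 i > 0" and "\<forall>i. N2 i > 0"
    and "\<forall>i. N1' i \<ge> 0" and "\<forall>i. N2' i \<ge> 0"
    and "dN \<ge> 0"
    and A: "A = system_matrix N1 N2 dN"
    and b: "b = system_rhs N1 N2 dN N1' N2'"
    and M: "M = {x. A *v x = b}"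
    and M0: "M0 = {x. is_arg_min (F0 A b) (\<lambda>y. y \<in> nonneg_orthant) x}"
  shows "(continuous_on UNIV (F0 A b) \<and> convex_on UNIV (F0 A b) \<and>
            filterlim (F0 A b) at_top (inf at_infinity (principal nonneg_orthant)))
       \<and> (M0 \<noteq> {} \<and> convex M0 \<and> compact M0)
       \<and> (M \<inter> nonneg_orthant \<noteq> {} \<longrightarrow>
            M0 = M \<inter> nonneg_orthant \<and> polytope M0 \<and> bounded M0 \<and>
            aff_dim M0 \<le> 2 * int CARD('n) ^ 2 + int CARD('n) \<and>
            (M \<inter> pos_orthant \<noteq> {} \<longrightarrow>
               aff_dim M0 = 2 * int CARD('n) ^ 2 + int CARD('n)))
       \<and> ((\<exists>x. M0 = {x}) \<or> M0 \<approx> (UNIV :: real set))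
       \<and> (\<exists>!x. is_arg_min norm (\<lambda>y. y \<in> M0) x)"
proof -
  let ?O = "nonneg_orthant :: (real ^ 'n unknown) set"
  let ?d = "2 * int CARD('n) ^ 2 + int CARD('n)"
  \<comment> \<open>This is the coefficient of the reserve's departures, by which the full-rank
    argument divides.\<close>
  have "0 < dN + N2 None" using assms(2,5) by (meson add_nonneg_pos)
  then have surj: "surj ((*v) A)"
    unfolding A using assms(1,2) by (intro surj_system_matrix) (metis less_irrefl)+
  \<comment> \<open>The count is (2n^2 + 5n + 2) - (4n + 2) = 2n^2 + n.\<close>
  have dim_M: "aff_dim M = ?d"
    unfolding M aff_dim_solutions[OF surj] by (simp add: card_unknown card_equation)
  have bound: "norm x \<le> real CARD('n unknown) * norm (A *v x)" if "x \<in> ?O" for x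
  proof -
    have "norm x \<le> (\<Sum>k\<in>UNIV. \<bar>x $ k\<bar>)" by (rule norm_le_l1_cart)
    also have "\<dots> \<le> (\<Sum>k\<in>(UNIV :: 'n unknown set). norm (A *v x))"
      using nonneg_component_le_norm[OF that] that
      by (intro sum_mono) (simp add: A nonneg_orthant_def)
    finally show ?thesis by simp
  qed
  have coercive: "filterlim (F0 A b) at_top (inf at_infinity (principal ?O))"
  proof (rule filterlim_F0)
    show "norm x \<le> real CARD('n unknown) * norm (A *v x)" if "x \<in> ?O" for x
      using that by (rule bound)
    have "0 < CARD('n unknown)" by (simp add: card_unknown)
    then show "0 < real CARD('n unknown)" by (simp only: of_nat_0_less_iff)
  qed
  have O: "closed ?O" "convex ?O"
    using polyhedron_nonneg_orthant by (rule polyhedron_imp_closed polyhedron_imp_convex)+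
  have "0 \<in> ?O" by (simp add: nonneg_orthant_def)
  then have nonempty: "?O \<noteq> {}" by blast
  have "convex_on ?O (F0 A b)"
    using convex_on_F0 O(2) by (meson convex_on_subset subset_UNIV)
  note K = coercive_arg_min_set[OF continuous_on_F0 this coercive O(1) nonempty, folded M0]
  have feasible: "M0 = M \<inter> ?O \<and> polytope M0 \<and> bounded M0 \<and> aff_dim M0 \<le> ?d \<and>
      (M \<inter> pos_orthant \<noteq> {} \<longrightarrow> aff_dim M0 = ?d)" if meets: "M \<inter> ?O \<noteq> {}"
  proof (intro conjI impI)
    obtain z where z: "A *v z = b" "z \<in> ?O" using meets M by blast
    have "F0 A b z = 0" using z by (simp add: F0_def)
    \<comment> \<open>The feasible point attains the value 0, the least possible, so the minimisers
      are the zeros of \<open>F0 A b\<close> on the orthant.\<close>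
    then have "x \<in> M0 \<longleftrightarrow> x \<in> ?O \<and> F0 A b x = 0" for x
      using z(2) by (auto simp: M0 is_arg_min_linorder F0_def)
    then show M0_eq: "M0 = M \<inter> ?O" by (auto simp: M F0_def)
    show "bounded M0" using K(3) by (rule compact_imp_bounded)
    moreover have "polyhedron M0"
      unfolding M0_eq M by (intro polyhedron_Int polyhedron_solutions polyhedron_nonneg_orthant)
    ultimately show "polytope M0" by (simp add: polytope_eq_bounded_polyhedron)
    show upper: "aff_dim M0 \<le> ?d" unfolding M0_eq dim_M[symmetric] by (rule aff_dim_subset) simp
    assume pos: "M \<inter> pos_orthant \<noteq> {}"
    have "affine M" unfolding M affine_def
      by (auto simp: matrix_vector_right_distrib matrix_vector_mult_scaleR scaleR_left_distrib[symmetric])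
    \<comment> \<open>A non-empty relatively open part of an affine set has the whole set as affine
      hull. Hence the chain from \<open>M \<inter> pos_orthant\<close> through \<open>M0\<close> to
      \<open>M\<close> has equal dimension at both ends.\<close>
    from affine_hull_affine_Int_open[OF this open_pos_orthant pos]
    have "aff_dim (M \<inter> pos_orthant) = aff_dim M" by (metis aff_dim_affine_hull)
    moreover have "aff_dim (M \<inter> pos_orthant) \<le> aff_dim M0"
      unfolding M0_eq
      by (rule aff_dim_subset) (auto simp: pos_orthant_def nonneg_orthant_def less_imp_le)
    ultimately show "aff_dim M0 = ?d" using upper dim_M by simp
  qed
  have "closed M0" using K(3) by (rule compact_imp_closed)
  show ?thesis
    by (intro conjI impI[OF feasible] continuous_on_F0 convex_on_F0 coercive K
        singleton_or_eqpoll_reals ex1_min_norm \<open>closed M0\<close>)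
qed

end
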